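(* Let $a=1+a_2\mathbf{j}+a_3\mathbf{k}$ with $a_2^2+a_3^2=1$, $b=b_1\mathbf{i}+b_2\mathbf{j}+b_3\mathbf{k}\neq0$ and $c$ be split quaternions (with $a_2,a_3,b_1,b_2,b_3\in\mathbb{R}$) such that $P_{ab}\neq0$. Let $T$ be a real solution of the cubic equation $$4P_{ab}^2T^3+4P_{ab}(2P_{ac}+I_b)T^2+\big[4P_{ab}P_{bc}+(2P_{ac}+I_b)^2\big]T+2P_{bc}(2P_{ac}+I_b)-2P_{ab}I_c=0$$ such that $Ta+b$ is invertible (i.e. $I_{Ta+b}\neq0$), and let $$N=\frac{2P_{ab}T^2+(2P_{ac}+I_b)T+2P_{bc}}{2P_{ab}}.$$ Then $$x=(Ta+b)^{-1}(aN-c)$$ is a solution of $ax^2+bx+c=0$.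
   Context: $\mathbb{H}_s$ is the real algebra of split quaternions $x=x_0+x_1\mathbf{i}+x_2\mathbf{j}+x_3\mathbf{k}$ ($x_i\in\mathbb{R}$), with $\mathbf{i}^2=-1$, $\mathbf{j}^2=\mathbf{k}^2=1$, $\mathbf{i}\mathbf{j}=\mathbf{k}=-\mathbf{j}\mathbf{i}$, $\mathbf{j}\mathbf{k}=-\mathbf{i}=-\mathbf{k}\mathbf{j}$, $\mathbf{k}\mathbf{i}=\mathbf{j}=-\mathbf{i}\mathbf{k}$. Put $I_x=x_0^2+x_1^2-x_2^2-x_3^2$ and $P_{xy}=x_0y_0+x_1y_1-x_2y_2-x_3y_3$. An element $x$ is invertible if and only if $I_x\neq0$. *)

theory Defs
  imports Complex_Main
begin

datatype splitq = SplitQ (sq0: real) (sq1: real) (sq2: real) (sq3: real)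

lemma splitq_eq_iff:
  "x = y \<longleftrightarrow> sq0 x = sq0 y \<and> sq1 x = sq1 y \<and> sq2 x = sq2 y \<and> sq3 x = sq3 y"
  by (auto intro: splitq.expand)

(* The product is the bilinear extension of the multiplication table of the basis 1, i, j, k;
   see the lemma splitq_table. *)
instantiation splitq :: real_algebra_1
begin

definition zero_splitq :: splitq where "0 = SplitQ 0 0 0 0"
definition one_splitq :: splitq where "1 = SplitQ 1 0 0 0"
definition uminus_splitq :: "splitq \<Rightarrow> splitq" where
  "- x = SplitQ (- sq0 x) (- sq1 x) (- sq2 x) (- sq3 x)"
definition plus_splitq :: "splitq \<Rightarrow> splitq \<Rightarrow> splitq" where
  "x + y = SplitQ (sq0 x + sq0 y) (sq1 x + sq1 y) (sq2 x + sq2 y) (sq3 x + sq3 y)"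
definition minus_splitq :: "splitq \<Rightarrow> splitq \<Rightarrow> splitq" where
  "x - y = SplitQ (sq0 x - sq0 y) (sq1 x - sq1 y) (sq2 x - sq2 y) (sq3 x - sq3 y)"
definition scaleR_splitq :: "real \<Rightarrow> splitq \<Rightarrow> splitq" where
  "r *\<^sub>R x = SplitQ (r * sq0 x) (r * sq1 x) (r * sq2 x) (r * sq3 x)"
definition times_splitq :: "splitq \<Rightarrow> splitq \<Rightarrow> splitq" where
  "x * y = SplitQ
     (sq0 x * sq0 y - sq1 x * sq1 y + sq2 x * sq2 y + sq3 x * sq3 y)
     (sq0 x * sq1 y + sq1 x * sq0 y - sq2 x * sq3 y + sq3 x * sq2 y)
     (sq0 x * sq2 y + sq2 x * sq0 y - sq1 x * sq3 y + sq3 x * sq1 y)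
     (sq0 x * sq3 y + sq3 x * sq0 y + sq1 x * sq2 y - sq2 x * sq1 y)"

instance
  by standard
    (simp_all add: splitq_eq_iff zero_splitq_def one_splitq_def uminus_splitq_def
      plus_splitq_def minus_splitq_def scaleR_splitq_def times_splitq_def algebra_simps)

end

lemmas splitq_arith_defs = zero_splitq_def one_splitq_def uminus_splitq_def
  plus_splitq_def minus_splitq_def scaleR_splitq_def times_splitq_def

definition sqi :: splitq where "sqi = SplitQ 0 1 0 0"
definition sqj :: splitq where "sqj = SplitQ 0 0 1 0"
definition sqk :: splitq where "sqk = SplitQ 0 0 0 1"

lemma splitq_table:
  "sqi * sqi = - 1" "sqj * sqj = 1" "sqk * sqk = 1"
  "sqi * sqj = sqk" "sqj * sqi = - sqk"
  "sqj * sqk = - sqi" "sqk * sqj = sqi"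
  "sqk * sqi = sqj" "sqi * sqk = - sqj"
  by (simp_all add: sqi_def sqj_def sqk_def splitq_arith_defs)

lemma splitq_expansion:
  "x = sq0 x *\<^sub>R 1 + sq1 x *\<^sub>R sqi + sq2 x *\<^sub>R sqj + sq3 x *\<^sub>R sqk"
  by (simp add: splitq_eq_iff sqi_def sqj_def sqk_def splitq_arith_defs)

definition sqI :: "splitq \<Rightarrow> real" where
  "sqI x = (sq0 x)\<^sup>2 + (sq1 x)\<^sup>2 - (sq2 x)\<^sup>2 - (sq3 x)\<^sup>2"

definition sqP :: "splitq \<Rightarrow> splitq \<Rightarrow> real" where
  "sqP x y = sq0 x * sq0 y + sq1 x * sq1 y - sq2 x * sq2 y - sq3 x * sq3 y"

definition sq_invertible :: "splitq \<Rightarrow> bool" where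
  "sq_invertible x \<longleftrightarrow> (\<exists>y. x * y = 1 \<and> y * x = 1)"

(* The inverse is unique when it exists (sq_inverse_eqI); for non-invertible x the value is
   unspecified. *)
definition sq_inverse :: "splitq \<Rightarrow> splitq" where
  "sq_inverse x = (THE y. x * y = 1 \<and> y * x = 1)"

lemma sq_inverse_eqI:
  assumes "x * y = 1" "y * x = 1"
  shows "sq_inverse x = y"
  unfolding sq_inverse_def
proof (rule the_equality)
  fix z assume z: "x * z = 1 \<and> z * x = 1"
  have "z = (y * x) * z" using assms by simp
  also have "\<dots> = y * (x * z)" by (simp only: mult.assoc)
  finally show "z = y" using z by simp
qed (use assms in simp)

lemma sqI_mult: "sqI (x * y) = sqI x * sqI y"
  by (simp add: sqI_def times_splitq_def power2_eq_square algebra_simps)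

lemma sq_invertible_iff: "sq_invertible x \<longleftrightarrow> sqI x \<noteq> 0"
proof
  assume "sq_invertible x"
  then obtain y where "x * y = 1" by (auto simp: sq_invertible_def)
  then have "sqI x * sqI y = 1"
    by (metis sqI_mult sqI_def one_splitq_def splitq.sel diff_zero add_0_right
        power_one power_zero_numeral)
  then show "sqI x \<noteq> 0" by auto
next
  assume nz: "sqI x \<noteq> 0"
  define c where "c = SplitQ (sq0 x) (- sq1 x) (- sq2 x) (- sq3 x)"
  have "x * c = sqI x *\<^sub>R 1" "c * x = sqI x *\<^sub>R 1"
    by (simp_all add: c_def sqI_def splitq_arith_defs power2_eq_square algebra_simps)
  then have "x * (inverse (sqI x) *\<^sub>R c) = 1 \<and> (inverse (sqI x) *\<^sub>R c) * x = 1"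
    using nz by simp
  then show "sq_invertible x" unfolding sq_invertible_def by blast
qed

end

theory Submission
  imports Defs
begin

text \<open>
  Every split quaternion \<open>x\<close> is a root of its characteristic polynomial
  \<open>X\<^sup>2 - 2 x\<^sub>0 X + I\<^sub>x\<close>. Replacing \<open>x\<^sup>2\<close> by \<open>t x - n\<close> with \<open>t = 2 x\<^sub>0\<close> and \<open>n = I\<^sub>x\<close>
  turns the quadratic equation into the linear one \<open>(t a + b) x = n a - c\<close>. The solution \<open>x\<close> of
  \<open>(T a + b) x = N a - c\<close> is therefore a root of the quadratic equation as soon as the parameters
  are consistent with it, that is, \<open>T = 2 x\<^sub>0\<close> and \<open>N = I\<^sub>x\<close>.

  Both conditions can be read off from \<open>u x = v\<close>, where \<open>u = T a + b\<close> and \<open>v = N a - c\<close>: the form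
  \<open>I\<close> is multiplicative, so \<open>I\<^sub>u I\<^sub>x = I\<^sub>v\<close>, and left multiplication by \<open>u\<close> scales its polar form
  \<open>P\<close> by \<open>I\<^sub>u\<close>, so \<open>P\<^sub>u\<^sub>v = I\<^sub>u x\<^sub>0\<close>. Since \<open>a\<close> is isotropic, the terms in \<open>T\<^sup>2\<close>, \<open>N\<^sup>2\<close> and
  \<open>T N\<close> disappear from \<open>I\<^sub>u\<close>, \<open>I\<^sub>v\<close> and \<open>P\<^sub>u\<^sub>v\<close>. Then \<open>T = 2 x\<^sub>0\<close> is exactly the defining
  formula of \<open>N\<close>, and substituting this formula into \<open>N = I\<^sub>x\<close> gives exactly the cubic
  equation for \<open>T\<close>.
\<close>

lemma sqI_add: "sqI (x + y) = sqI x + 2 * sqP x y + sqI y"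
  by (simp add: sqI_def sqP_def plus_splitq_def power2_eq_square algebra_simps)

lemma sqI_diff: "sqI (x - y) = sqI x - 2 * sqP x y + sqI y"
  by (simp add: sqI_def sqP_def minus_splitq_def power2_eq_square algebra_simps)

lemma sqI_scaleR: "sqI (r *\<^sub>R x) = r\<^sup>2 * sqI x"
  by (simp add: sqI_def scaleR_splitq_def power2_eq_square algebra_simps)

lemma sqP_self: "sqP x x = sqI x"
  by (simp add: sqI_def sqP_def power2_eq_square)

lemma sqP_commute: "sqP x y = sqP y x"
  by (simp add: sqP_def mult.commute)

lemma sqP_add_left: "sqP (x + y) z = sqP x z + sqP y z"
  by (simp add: sqP_def plus_splitq_def algebra_simps)

lemma sqP_diff_right: "sqP x (y - z) = sqP x y - sqP x z"
  by (simp add: sqP_def minus_splitq_def algebra_simps)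

lemma sqP_scaleR_left: "sqP (r *\<^sub>R x) y = r * sqP x y"
  by (simp add: sqP_def scaleR_splitq_def algebra_simps)

lemma sqP_scaleR_right: "sqP x (r *\<^sub>R y) = r * sqP x y"
  by (simp add: sqP_def scaleR_splitq_def algebra_simps)

text \<open>
  This is the polarized identity \<open>P (u y) (u x) = I\<^sub>u P y x\<close> at \<open>y = 1\<close>, where \<open>P 1 x = x\<^sub>0\<close>. It
  recovers the real part of \<open>x\<close> from \<open>u\<close> and \<open>u x\<close> without computing an inverse of \<open>u\<close>.
\<close>

lemma sqP_mult_left: "sqP u (u * x) = sqI u * sq0 x"
  by (simp add: sqP_def sqI_def times_splitq_def power2_eq_square algebra_simps)

lemma splitq_characteristic_equation: "x\<^sup>2 = (2 * sq0 x) *\<^sub>R x - sqI x *\<^sub>R 1"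
  by (simp add: power2_eq_square splitq_eq_iff sqI_def splitq_arith_defs algebra_simps)

lemma mult_sq_inverse_left:
  assumes "sq_invertible u"
  shows "u * (sq_inverse u * v) = v"
proof -
  obtain w where w: "u * w = 1" "w * u = 1"
    using assms by (auto simp: sq_invertible_def)
  then have "sq_inverse u = w" by (rule sq_inverse_eqI)
  with w show ?thesis by (simp flip: mult.assoc)
qed

text \<open>
  The characteristic equation gives \<open>a x\<^sup>2 = t (a x) - n a\<close>, so the quadratic expression equals
  \<open>(t a + b) x - (n a - c)\<close>.
\<close>

lemma quadratic_root_if_linear:
  fixes a b c x :: splitq
  assumes "((2 * sq0 x) *\<^sub>R a + b) * x = sqI x *\<^sub>R a - c"
  shows "a * x\<^sup>2 + b * x + c = 0"
proof -
  have "a * x\<^sup>2 = (2 * sq0 x) *\<^sub>R (a * x) - sqI x *\<^sub>R a"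
    by (simp add: splitq_characteristic_equation right_diff_distrib)
  then have "a * x\<^sup>2 + b * x + c = ((2 * sq0 x) *\<^sub>R a + b) * x - (sqI x *\<^sub>R a - c)"
    by (simp add: distrib_right)
  with assms show ?thesis by simp
qed

text \<open>
  It remains to see that the prescribed \<open>T\<close> and \<open>N\<close> agree with \<open>2 x\<^sub>0\<close> and \<open>I\<^sub>x\<close>. Each
  agreement is obtained after multiplication by the non-zero number \<open>I\<^sub>u\<close>, where \<open>u = T a + b\<close>.
\<close>

lemma quadratic_root_isotropic:
  fixes a b c x :: splitq and T N :: real
  assumes a: "sqI a = 0"
    and P: "sqP a b \<noteq> 0"
    and cubic: "4 * (sqP a b)\<^sup>2 * T ^ 3
         + 4 * sqP a b * (2 * sqP a c + sqI b) * T\<^sup>2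
         + (4 * sqP a b * sqP b c + (2 * sqP a c + sqI b)\<^sup>2) * T
         + 2 * sqP b c * (2 * sqP a c + sqI b) - 2 * sqP a b * sqI c = 0"
    and u: "sqI (T *\<^sub>R a + b) \<noteq> 0"
    and N: "2 * sqP a b * N = 2 * sqP a b * T\<^sup>2 + (2 * sqP a c + sqI b) * T + 2 * sqP b c"
    and x: "(T *\<^sub>R a + b) * x = N *\<^sub>R a - c"
  shows "a * x\<^sup>2 + b * x + c = 0"
proof -
  let ?u = "T *\<^sub>R a + b" and ?v = "N *\<^sub>R a - c"
  have Iu: "sqI ?u = 2 * T * sqP a b + sqI b"
    by (simp add: sqI_add sqI_scaleR sqP_scaleR_left a)
  have Iv: "sqI ?v = sqI c - 2 * N * sqP a c"
    by (simp add: sqI_diff sqI_scaleR sqP_scaleR_left a)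
  have Puv: "sqP ?u ?v = N * sqP a b - T * sqP a c - sqP b c"
    by (simp add: sqP_add_left sqP_diff_right sqP_scaleR_left sqP_scaleR_right
        sqP_self a sqP_commute[of b a] algebra_simps)

  have "sqI ?u * (2 * sq0 x) = 2 * sqP ?u ?v"
    by (simp add: sqP_mult_left flip: x)
  also have "\<dots> = sqI ?u * T"
    unfolding Iu Puv using N by (simp add: power2_eq_square algebra_simps)
  finally have T: "2 * sq0 x = T"
    using u by simp

  \<comment> \<open>With the value of \<open>N\<close> inserted, the cubic polynomial is the left side minus the right side.\<close>
  have "(2 * sqP a b * N) * (2 * sqP a b * T + 2 * sqP a c + sqI b) = 2 * sqP a b * sqI c"
    unfolding N using cubic by (simp add: power2_eq_square power3_eq_cube algebra_simps)
  then have "N * (2 * sqP a b * T + 2 * sqP a c + sqI b) = sqI c"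
    using P by (simp add: mult.assoc)
  then have "sqI ?u * N = sqI ?v"
    unfolding Iu Iv by (simp add: algebra_simps)
  also have "\<dots> = sqI ?u * sqI x"
    by (simp add: sqI_mult flip: x)
  finally have "N = sqI x"
    using u by simp

  with T x show ?thesis
    by (intro quadratic_root_if_linear) simp
qed

theorem theorem4p1:
  fixes a b c x :: splitq
    and a2 a3 b1 b2 b3 T N :: real
  assumes "a = 1 + a2 *\<^sub>R sqj + a3 *\<^sub>R sqk"
    and "a2\<^sup>2 + a3\<^sup>2 = 1"
    and "b = b1 *\<^sub>R sqi + b2 *\<^sub>R sqj + b3 *\<^sub>R sqk"
    and "b \<noteq> 0"
    and "sqP a b \<noteq> 0"
    and "4 * (sqP a b)\<^sup>2 * T ^ 3
         + 4 * sqP a b * (2 * sqP a c + sqI b) * T\<^sup>2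
         + (4 * sqP a b * sqP b c + (2 * sqP a c + sqI b)\<^sup>2) * T
         + 2 * sqP b c * (2 * sqP a c + sqI b) - 2 * sqP a b * sqI c = 0"
    and "sq_invertible (T *\<^sub>R a + b)"
    and "N = (2 * sqP a b * T\<^sup>2 + (2 * sqP a c + sqI b) * T + 2 * sqP b c) / (2 * sqP a b)"
    and "x = sq_inverse (T *\<^sub>R a + b) * (N *\<^sub>R a - c)"
  shows "a * x\<^sup>2 + b * x + c = 0"
proof (rule quadratic_root_isotropic)
  show "sqI a = 0"
    using assms(1,2) by (simp add: sqI_def sqj_def sqk_def splitq_arith_defs)
  show "sqI (T *\<^sub>R a + b) \<noteq> 0"
    using assms(7) by (simp add: sq_invertible_iff)
  show "2 * sqP a b * N = 2 * sqP a b * T\<^sup>2 + (2 * sqP a c + sqI b) * T + 2 * sqP b c"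
    using assms(5,8) by simp
  show "(T *\<^sub>R a + b) * x = N *\<^sub>R a - c"
    unfolding assms(9) using assms(7) by (rule mult_sq_inverse_left)
qed (use assms(5,6) in simp_all)

end
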